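(* Let $(J,\mathcal{B})$ be a set-algebra and let $\varphi:\mathcal{B}\to\mathbb{R}$ be an increasing submodular setfunction with $\varphi(\emptyset)=0$. Let $\mathrm{mm}_+(\varphi)$ be the set of nonnegative charges $\alpha$ on $\mathcal{B}$ with $\alpha\le\varphi$. Then for all $\alpha,\beta\in\mathrm{mm}_+(\varphi)$ there is $\gamma\in\mathrm{mm}_+(\varphi)$ such that $\alpha\le\gamma\le\alpha\lor\beta$ and $\gamma(J)\ge\beta(J)$.
   Context: A set-algebra $(J,\mathcal{B})$: a family of subsets of $J$ containing $\emptyset,J$, closed under finite unions, intersections and complements. Submodular: $\varphi(S\cup T)+\varphi(S\cap T)\le\varphi(S)+\varphi(T)$. A charge is a bounded finitely additive real-valued function on $\mathcal{B}$. For setfunctions $\alpha,\beta$ on $\mathcal{B}$, $(\alpha\lor\beta)(X)=\sup\{\alpha(Y)+\beta(X\setminus Y):Y\in\mathcal{B},Y\subseteq X\}$. Inequalities between setfunctions are pointwise. *)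

theory Defs
  imports "HOL-Analysis.Analysis"
begin

text \<open>
  A set-algebra is the library locale \<^const>\<open>algebra\<close>. Setfunctions on \<open>B\<close> are total functions
  on sets, of which only the values on \<open>B\<close> matter; every condition is relativised to \<open>B\<close>.
\<close>

definition submodular_on :: "'a set set \<Rightarrow> ('a set \<Rightarrow> real) \<Rightarrow> bool" where
  "submodular_on B \<phi> \<longleftrightarrow> (\<forall>S\<in>B. \<forall>T\<in>B. \<phi> (S \<union> T) + \<phi> (S \<inter> T) \<le> \<phi> S + \<phi> T)"

definition setfun_le :: "'a set set \<Rightarrow> ('a set \<Rightarrow> real) \<Rightarrow> ('a set \<Rightarrow> real) \<Rightarrow> bool" where
  "setfun_le B \<alpha> \<beta> \<longleftrightarrow> (\<forall>X\<in>B. \<alpha> X \<le> \<beta> X)"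

definition charge :: "'a set set \<Rightarrow> ('a set \<Rightarrow> real) \<Rightarrow> bool" where
  "charge B \<alpha> \<longleftrightarrow> Measure_Space.additive B \<alpha> \<and> bounded (\<alpha> ` B)"

definition mm_plus :: "'a set set \<Rightarrow> ('a set \<Rightarrow> real) \<Rightarrow> ('a set \<Rightarrow> real) set" where
  "mm_plus B \<phi> = {\<alpha>. charge B \<alpha> \<and> setfun_le B (\<lambda>_. 0) \<alpha> \<and> setfun_le B \<alpha> \<phi>}"

text \<open>
  The supremum is taken in \<^typ>\<open>real\<close>, so it is meaningful only for a nonempty set that is bounded
  above; for charges this is \<open>setfun_join_nonempty\<close> and \<open>setfun_join_bdd_above\<close>.
\<close>

definition setfun_join ::
    "'a set set \<Rightarrow> ('a set \<Rightarrow> real) \<Rightarrow> ('a set \<Rightarrow> real) \<Rightarrow> 'a set \<Rightarrow> real" where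
  "setfun_join B \<alpha> \<beta> X = Sup {\<alpha> Y + \<beta> (X - Y) | Y. Y \<in> B \<and> Y \<subseteq> X}"

lemma setfun_join_nonempty:
  assumes "algebra J B"
  shows "{\<alpha> Y + \<beta> (X - Y) | Y. Y \<in> B \<and> Y \<subseteq> X} \<noteq> {}"
proof -
  interpret algebra J B by fact
  show ?thesis by blast
qed

lemma setfun_join_bdd_above:
  assumes "algebra J B" "charge B \<alpha>" "charge B \<beta>" "X \<in> B"
  shows "bdd_above {\<alpha> Y + \<beta> (X - Y) | Y. Y \<in> B \<and> Y \<subseteq> X}"
proof -
  interpret algebra J B by fact
  obtain a where a: "\<And>Y. Y \<in> B \<Longrightarrow> \<bar>\<alpha> Y\<bar> \<le> a"
    using assms(2) by (auto simp: charge_def bounded_iff)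
  obtain b where b: "\<And>Y. Y \<in> B \<Longrightarrow> \<bar>\<beta> Y\<bar> \<le> b"
    using assms(3) by (auto simp: charge_def bounded_iff)
  have "\<alpha> Y + \<beta> (X - Y) \<le> a + b" if "Y \<in> B" for Y
    using a[OF that] b[of "X - Y"] that assms(4) by fastforce
  then show ?thesis by (intro bdd_aboveI[of _ "a + b"]) blast
qed

end

theory Submission
  imports Defs
begin

text \<open>
  Put \<open>d = \<beta> - \<alpha>\<close> and let \<open>\<nu> X\<close> be the supremum of \<open>d\<close> over the members of \<open>B\<close> inside \<open>X\<close>, so that
  \<open>\<alpha> \<or> \<beta> = \<alpha> + \<nu>\<close>. The setfunction \<open>\<psi> X = inf {(\<phi> - \<alpha>) Y + \<nu> (X - Y) | Y \<in> B}\<close> is increasing and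
  submodular, it lies below both \<open>\<phi> - \<alpha>\<close> and \<open>\<nu>\<close>, it vanishes at the empty set, and \<open>\<psi> J \<ge> d J\<close>. By
  Zorn's lemma there is a minimal increasing submodular setfunction \<open>\<delta>\<close> below \<open>\<psi>\<close> with the same
  values at the empty set and \<open>J\<close>. For \<open>A \<in> B\<close> the setfunction \<open>X \<mapsto> \<delta> (X \<inter> A) + \<delta> (X \<union> A) - \<delta> A\<close>
  is again such a function and lies below \<open>\<delta>\<close>, so it equals \<open>\<delta>\<close>; hence \<open>\<delta>\<close> is additive, and
  \<open>\<gamma> = \<alpha> + \<delta>\<close> is as desired.
\<close>

section \<open>Real infima and suprema, and basic facts on setfunctions\<close>

lemma le_cInf_add_cInf:
  fixes A B :: "real set"
  assumes "A \<noteq> {}" "B \<noteq> {}" and le: "\<And>a b. a \<in> A \<Longrightarrow> b \<in> B \<Longrightarrow> x \<le> a + b"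
  shows "x \<le> Inf A + Inf B"
proof -
  have "x - a \<le> Inf B" if "a \<in> A" for a
    using le[OF that] by (intro cInf_greatest assms(2)) (simp add: algebra_simps)
  then have "x - Inf B \<le> Inf A"
    by (intro cInf_greatest assms(1)) (simp add: algebra_simps)
  then show ?thesis by simp
qed

lemma cSup_add_cSup_le:
  fixes A B :: "real set"
  assumes "A \<noteq> {}" "B \<noteq> {}" and le: "\<And>a b. a \<in> A \<Longrightarrow> b \<in> B \<Longrightarrow> a + b \<le> x"
  shows "Sup A + Sup B \<le> x"
proof -
  have "Sup B \<le> x - a" if "a \<in> A" for a
    using le[OF that] by (intro cSup_least assms(2)) (simp add: algebra_simps)
  then have "Sup A \<le> x - Sup B"
    by (intro cSup_least assms(1)) (simp add: algebra_simps)
  then show ?thesis by simp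
qed

lemma increasingI:
  "(\<And>X Y. X \<subseteq> Y \<Longrightarrow> X \<in> B \<Longrightarrow> Y \<in> B \<Longrightarrow> f X \<le> f Y) \<Longrightarrow> increasing B f"
  unfolding increasing_def by blast

lemma submodular_onD:
  "submodular_on B f \<Longrightarrow> S \<in> B \<Longrightarrow> T \<in> B \<Longrightarrow> f (S \<union> T) + f (S \<inter> T) \<le> f S + f T"
  unfolding submodular_on_def by blast

lemma additive_empty_real:
  fixes f :: "'a set \<Rightarrow> real"
  assumes "Measure_Space.additive B f" "{} \<in> B"
  shows "f {} = 0"
  using additiveD[OF assms(1), of "{}" "{}"] assms(2) by simp

section \<open>Minimal increasing submodular setfunctions\<close>

lemma increasing_cINF:
  fixes C :: "('a set \<Rightarrow> real) set"
  assumes "C \<noteq> {}" and "\<And>f. f \<in> C \<Longrightarrow> increasing B f"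
    and bdd: "\<And>X. X \<in> B \<Longrightarrow> bdd_below ((\<lambda>f. f X) ` C)"
  shows "increasing B (\<lambda>X. INF f\<in>C. f X)"
proof (rule increasingI)
  fix X Y assume XY: "X \<subseteq> Y" "X \<in> B" "Y \<in> B"
  show "(INF f\<in>C. f X) \<le> (INF f\<in>C. f Y)"
    by (rule cINF_mono[OF assms(1) bdd[OF XY(2)]]) (use assms(2) XY increasingD in blast)
qed

text \<open>Infima do not preserve submodularity in general. On a chain, the smaller
  \<open>h\<close> of \<open>f\<close> and \<open>g\<close> satisfies the inequality at
  \<open>S\<close> and \<open>T\<close>, which bounds the sum of the two infima by
  \<open>f S + g T\<close>.\<close>

lemma submodular_on_cINF_chain:
  fixes C :: "('a set \<Rightarrow> real) set"
  assumes "algebra J B" "C \<noteq> {}" and sub: "\<And>f. f \<in> C \<Longrightarrow> submodular_on B f"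
    and chain: "\<And>f g. f \<in> C \<Longrightarrow> g \<in> C \<Longrightarrow> f \<le> g \<or> g \<le> f"
    and bdd: "\<And>X. X \<in> B \<Longrightarrow> bdd_below ((\<lambda>f. f X) ` C)"
  shows "submodular_on B (\<lambda>X. INF f\<in>C. f X)"
  unfolding submodular_on_def
proof (intro ballI)
  interpret algebra J B by fact
  fix S T assume ST: "S \<in> B" "T \<in> B"
  have "(INF f\<in>C. f (S \<union> T)) + (INF f\<in>C. f (S \<inter> T)) \<le> f S + g T" if fg: "f \<in> C" "g \<in> C" for f g
  proof -
    obtain h where h: "h \<in> C" "h \<le> f" "h \<le> g"
      using chain[OF fg] fg by auto
    have "(INF f\<in>C. f (S \<union> T)) \<le> h (S \<union> T)" "(INF f\<in>C. f (S \<inter> T)) \<le> h (S \<inter> T)"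
      using ST h(1) by (auto intro!: cINF_lower bdd)
    then show ?thesis
      using submodular_onD[OF sub[OF h(1)] ST] le_funD[OF h(2), of S] le_funD[OF h(3), of T] by linarith
  qed
  then show "(INF f\<in>C. f (S \<union> T)) + (INF f\<in>C. f (S \<inter> T)) \<le> (INF f\<in>C. f S) + (INF f\<in>C. f T)"
    using assms(2) by (intro le_cInf_add_cInf) auto
qed

text \<open>By distributivity, intersection with \<open>A\<close>, like union with \<open>A\<close>
  in the next lemma, preserves unions and intersections, so composing with it preserves
  submodularity.\<close>

lemma submodular_on_Int:
  assumes "algebra J B" "A \<in> B" "submodular_on B f"
  shows "submodular_on B (\<lambda>X. f (X \<inter> A))"
  unfolding submodular_on_def
proof (intro ballI)
  interpret algebra J B by fact
  fix S T assume "S \<in> B" "T \<in> B"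
  moreover have "(S \<union> T) \<inter> A = (S \<inter> A) \<union> (T \<inter> A)" "(S \<inter> T) \<inter> A = (S \<inter> A) \<inter> (T \<inter> A)"
    by auto
  ultimately show "f ((S \<union> T) \<inter> A) + f ((S \<inter> T) \<inter> A) \<le> f (S \<inter> A) + f (T \<inter> A)"
    using submodular_onD[OF assms(3), of "S \<inter> A" "T \<inter> A"] assms(2) by (metis Int)
qed

lemma submodular_on_Un:
  assumes "algebra J B" "A \<in> B" "submodular_on B f"
  shows "submodular_on B (\<lambda>X. f (X \<union> A))"
  unfolding submodular_on_def
proof (intro ballI)
  interpret algebra J B by fact
  fix S T assume "S \<in> B" "T \<in> B"
  moreover have "(S \<union> T) \<union> A = (S \<union> A) \<union> (T \<union> A)" "(S \<inter> T) \<union> A = (S \<union> A) \<inter> (T \<union> A)"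
    by auto
  ultimately show "f ((S \<union> T) \<union> A) + f ((S \<inter> T) \<union> A) \<le> f (S \<union> A) + f (T \<union> A)"
    using submodular_onD[OF assms(3), of "S \<union> A" "T \<union> A"] assms(2) by (metis Un)
qed

text \<open>
  Vanishing outside \<open>B\<close> makes the pointwise order on all sets agree with the one on \<open>B\<close>, so that it
  is antisymmetric on this family.
\<close>

definition increasing_submodulars ::
    "'a set \<Rightarrow> 'a set set \<Rightarrow> real \<Rightarrow> ('a set \<Rightarrow> real) set" where
  "increasing_submodulars J B c =
    {f. increasing B f \<and> submodular_on B f \<and> f {} = 0 \<and> f J = c \<and> (\<forall>X. X \<notin> B \<longrightarrow> f X = 0)}"

lemma increasing_submodulars_nonneg:
  assumes "algebra J B" "f \<in> increasing_submodulars J B c"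
  shows "0 \<le> f X"
proof (cases "X \<in> B")
  case True
  interpret algebra J B by fact
  show ?thesis
    using increasingD[of B f "{}" X] assms(2) True by (auto simp: increasing_submodulars_def)
next
  case False
  then show ?thesis using assms(2) by (auto simp: increasing_submodulars_def)
qed

text \<open>The pointwise infimum serves as lower bound; nonnegativity of the members keeps it
  finite. This is the chain condition for Zorn's lemma.\<close>

lemma increasing_submodulars_chain_lower_bound:
  assumes "algebra J B" "C \<subseteq> increasing_submodulars J B c" "C \<noteq> {}"
    and "\<And>f g. f \<in> C \<Longrightarrow> g \<in> C \<Longrightarrow> f \<le> g \<or> g \<le> f"
  shows "\<exists>u\<in>increasing_submodulars J B c. \<forall>f\<in>C. u \<le> f"
proof
  let ?u = "\<lambda>X. INF f\<in>C. f X"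
  have bdd: "bdd_below ((\<lambda>f. f X) ` C)" for X
    using increasing_submodulars_nonneg[OF assms(1)] assms(2) by (intro bdd_belowI2[of _ 0]) blast
  show "\<forall>f\<in>C. ?u \<le> f"
    by (auto intro!: le_funI cINF_lower bdd)
  have C: "increasing B f" "submodular_on B f" "f {} = 0" "f J = c" "X \<notin> B \<Longrightarrow> f X = 0"
    if "f \<in> C" for f X
    using that assms(2) by (auto simp: increasing_submodulars_def)
  have const: "?u X = k" if "\<And>f. f \<in> C \<Longrightarrow> f X = k" for X k
  proof -
    have "(\<lambda>f. f X) ` C = {k}" using that assms(3) by force
    then show ?thesis by simp
  qed
  have "increasing B ?u"
    using assms(3) C(1) bdd by (rule increasing_cINF)
  moreover have "submodular_on B ?u"
    using assms(1,3) C(2) assms(4) bdd by (rule submodular_on_cINF_chain)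
  moreover have "?u {} = 0" "?u J = c"
    using const[of "{}" 0] const[of J c] C(3,4) by blast+
  moreover have "?u X = 0" if "X \<notin> B" for X
    using C(5) that by (intro const) blast
  ultimately show "?u \<in> increasing_submodulars J B c"
    unfolding increasing_submodulars_def by blast
qed

lemma minimal_increasing_submodular_below:
  assumes "algebra J B" "f \<in> increasing_submodulars J B c"
  shows "\<exists>m\<in>increasing_submodulars J B c. m \<le> f \<and> (\<forall>g\<in>increasing_submodulars J B c. g \<le> m \<longrightarrow> g = m)"
proof -
  let ?A = "{g \<in> increasing_submodulars J B c. g \<le> f}"
  \<comment> \<open>The order is reversed, so that the maximal element from Zorn's lemma is a
    minimal setfunction.\<close>
  let ?r = "relation_of (\<lambda>g h. h \<le> g) ?A"
  have "\<exists>m\<in>?A. \<forall>g\<in>?A. g \<le> m \<longrightarrow> g = m"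
  proof (rule predicate_Zorn)
    show "partial_order_on ?A ?r"
      by (rule partial_order_on_relation_ofI) auto
    fix C assume "C \<in> Chains ?r"
    then have C: "C \<subseteq> ?A" and chain: "\<And>g h. g \<in> C \<Longrightarrow> h \<in> C \<Longrightarrow> g \<le> h \<or> h \<le> g"
      by (auto simp: Chains_def relation_of_def)
    show "\<exists>u\<in>?A. \<forall>g\<in>C. u \<le> g"
    proof (cases "C = {}")
      case True
      then show ?thesis using assms(2) by auto
    next
      case False
      obtain u where u: "u \<in> increasing_submodulars J B c" "\<forall>g\<in>C. u \<le> g"
        using increasing_submodulars_chain_lower_bound[OF assms(1) _ False chain] C by blast
      moreover have "u \<le> f" using False u(2) C by (blast intro: order_trans)
      ultimately show ?thesis by blast
    qed
  qed
  then show ?thesis by (blast intro: order_trans)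
qed

text \<open>On \<open>B\<close>, submodularity at \<open>X\<close> and \<open>A\<close> says exactly
  that \<open>?g\<close> lies below \<open>f\<close>, and minimality turns this into an equality. At
  \<open>J\<close> the two terms \<open>f A\<close> cancel and leave \<open>f J\<close>, so
  \<open>?g\<close> has the prescribed total value.\<close>

lemma minimal_increasing_submodular_modular:
  assumes "algebra J B" and f: "f \<in> increasing_submodulars J B c"
    and min: "\<And>g. g \<in> increasing_submodulars J B c \<Longrightarrow> g \<le> f \<Longrightarrow> g = f"
    and "X \<in> B" "A \<in> B"
  shows "f (X \<union> A) + f (X \<inter> A) = f X + f A"
proof -
  interpret algebra J B by fact
  let ?g = "\<lambda>X. if X \<in> B then f (X \<inter> A) + f (X \<union> A) - f A else 0"
  have F: "increasing B f" "submodular_on B f" "f {} = 0" "f J = c" "\<And>X. X \<notin> B \<Longrightarrow> f X = 0"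
    using f by (auto simp: increasing_submodulars_def)
  have inc: "increasing B ?g"
  proof (rule increasingI)
    fix S T assume ST: "S \<subseteq> T" "S \<in> B" "T \<in> B"
    have "f (S \<inter> A) \<le> f (T \<inter> A)" "f (S \<union> A) \<le> f (T \<union> A)"
      using ST \<open>A \<in> B\<close> by (auto intro!: increasingD[OF F(1)])
    then show "?g S \<le> ?g T" using ST by simp
  qed
  have sub: "submodular_on B ?g"
    unfolding submodular_on_def
  proof (intro ballI)
    fix S T assume ST: "S \<in> B" "T \<in> B"
    then show "?g (S \<union> T) + ?g (S \<inter> T) \<le> ?g S + ?g T"
      using submodular_onD[OF submodular_on_Int[OF assms(1) \<open>A \<in> B\<close> F(2)] ST]
        submodular_onD[OF submodular_on_Un[OF assms(1) \<open>A \<in> B\<close> F(2)] ST] by (simp add: Un Int)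
  qed
  have "A \<subseteq> J" using \<open>A \<in> B\<close> sets_into_space by blast
  then have "?g J = c" "?g {} = 0"
    using F by (simp_all add: Int_absorb1 Un_absorb2)
  with inc sub have "?g \<in> increasing_submodulars J B c"
    by (simp add: increasing_submodulars_def)
  moreover have "?g \<le> f"
  proof (rule le_funI)
    fix X show "?g X \<le> f X"
      using submodular_onD[OF F(2), of X A] \<open>A \<in> B\<close> F(5)[of X] by auto
  qed
  ultimately have "?g = f" by (rule min)
  then have "?g X = f X" by (rule fun_cong)
  then show ?thesis using \<open>X \<in> B\<close> by simp
qed

text \<open>For disjoint sets the modular identity of a minimal \<open>m\<close>, together with
  \<open>m {} = 0\<close>, is additivity. Boundedness follows from 0 \<le> \<open>m X\<close> \<le>
  \<open>m J\<close>.\<close>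

lemma increasing_submodular_dominates_charge:
  assumes "algebra J B" "increasing B \<psi>" "submodular_on B \<psi>" "\<psi> {} = 0"
  shows "\<exists>\<delta>. charge B \<delta> \<and> setfun_le B (\<lambda>_. 0) \<delta> \<and> setfun_le B \<delta> \<psi> \<and> \<delta> J = \<psi> J"
proof -
  interpret algebra J B by fact
  let ?f = "\<lambda>X. if X \<in> B then \<psi> X else 0"
  have "?f \<in> increasing_submodulars J B (\<psi> J)"
    using assms by (simp add: increasing_submodulars_def increasing_def submodular_on_def Un Int)
  then obtain m where m: "m \<in> increasing_submodulars J B (\<psi> J)" and le: "m \<le> ?f"
    and min: "\<And>g. g \<in> increasing_submodulars J B (\<psi> J) \<Longrightarrow> g \<le> m \<Longrightarrow> g = m"
    using minimal_increasing_submodular_below[OF assms(1)] by blast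
  have "Measure_Space.additive B m"
  proof (unfold additive_def, intro ballI impI)
    fix S T assume "S \<in> B" "T \<in> B" "S \<inter> T = {}"
    then show "m (S \<union> T) = m S + m T"
      using minimal_increasing_submodular_modular[OF assms(1) m min, of S T] m
      by (simp add: increasing_submodulars_def)
  qed
  moreover have nn: "0 \<le> m X" for X
    using increasing_submodulars_nonneg[OF assms(1) m] .
  moreover have "m X \<le> m J" if "X \<in> B" for X
    using m that sets_into_space[OF that] increasingD[of B m X J]
    by (simp add: increasing_submodulars_def)
  then have "bounded (m ` B)"
    using nn by (auto simp: bounded_iff)
  moreover have "m X \<le> \<psi> X" if "X \<in> B" for X
    using le_funD[OF le, of X] that by simp
  moreover have "m J = \<psi> J"
    using m by (simp add: increasing_submodulars_def)
  ultimately show ?thesis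
    by (auto simp: charge_def setfun_le_def)
qed

section \<open>The upper variation of a charge\<close>

text \<open>For a charge \<open>d\<close> this is, on \<open>B\<close>, the positive part of its
  Jordan decomposition, that is, the join of \<open>d\<close> with 0.\<close>

definition sup_variation :: "'a set set \<Rightarrow> ('a set \<Rightarrow> real) \<Rightarrow> 'a set \<Rightarrow> real" where
  "sup_variation B d X = (SUP Y\<in>{Y \<in> B. Y \<subseteq> X}. d Y)"

lemma sup_variation_upper:
  assumes "charge B d" "Y \<in> B" "Y \<subseteq> X"
  shows "d Y \<le> sup_variation B d X"
  unfolding sup_variation_def
proof (rule cSUP_upper)
  have "bounded (d ` {Y \<in> B. Y \<subseteq> X})"
    using assms(1) by (auto simp: charge_def intro: bounded_subset)
  then show "bdd_above (d ` {Y \<in> B. Y \<subseteq> X})"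
    by (rule bounded_imp_bdd_above)
qed (use assms in simp)

lemma sup_variation_empty:
  assumes "algebra J B" "charge B d"
  shows "sup_variation B d {} = 0"
proof -
  interpret algebra J B by fact
  have "{Y \<in> B. Y \<subseteq> {}} = {{}}" by auto
  then show ?thesis
    using assms additive_empty_real[of B d] by (simp add: sup_variation_def charge_def)
qed

text \<open>The hypotheses say that \<open>1\<^sub>P + 1\<^sub>Q \<le> 1\<^sub>S + 1\<^sub>T\<close>.\<close>

lemma sup_variation_add_le:
  assumes "algebra J B" and d: "charge B d" and B: "S \<in> B" "T \<in> B"
    and sub_Un: "P \<union> Q \<subseteq> S \<union> T" and sub_Int: "P \<inter> Q \<subseteq> S \<inter> T"
  shows "sup_variation B d P + sup_variation B d Q \<le> sup_variation B d S + sup_variation B d T"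
proof -
  interpret algebra J B by fact
  have add: "d (U \<union> V) = d U + d V" if "U \<inter> V = {}" "U \<in> B" "V \<in> B" for U V
    using d that additiveD by (auto simp: charge_def)
  have "d Y + d Z \<le> sup_variation B d S + sup_variation B d T"
    if YZ: "Y \<in> B" "Y \<subseteq> P" "Z \<in> B" "Z \<subseteq> Q" for Y Z
  proof -
    \<comment> \<open>The mass of \<open>Y\<close> and \<open>Z\<close> is redistributed: the part
      of \<open>Y \<union> Z\<close> inside \<open>S\<close> goes to \<open>S\<close>. The rest lies
      in \<open>T\<close> and takes up \<open>Y \<inter> Z\<close>, which is contained in
      \<open>S \<inter> T\<close> and hence disjoint from that rest.\<close>
    have "d Y + d Z = d Y + d (Z - Y) + d (Y \<inter> Z)"
    proof -
      have "(Z - Y) \<inter> (Y \<inter> Z) = {}" "(Z - Y) \<union> (Y \<inter> Z) = Z" by auto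
      then show ?thesis using add[of "Z - Y" "Y \<inter> Z"] YZ by auto
    qed
    also have "d Y + d (Z - Y) = d (Y \<union> Z)"
      using add[of Y "Z - Y"] YZ by (simp add: Diff)
    also have "d (Y \<union> Z) = d ((Y \<union> Z) \<inter> S) + d ((Y \<union> Z) - S)"
    proof -
      have "(Y \<union> Z) \<inter> S \<inter> ((Y \<union> Z) - S) = {}" "(Y \<union> Z) \<inter> S \<union> ((Y \<union> Z) - S) = Y \<union> Z" by auto
      then show ?thesis using add[of "(Y \<union> Z) \<inter> S" "(Y \<union> Z) - S"] YZ B by auto
    qed
    also have "\<dots> + d (Y \<inter> Z) = d ((Y \<union> Z) \<inter> S) + d ((Y \<union> Z - S) \<union> (Y \<inter> Z))"
    proof -
      have "(Y \<union> Z - S) \<inter> (Y \<inter> Z) = {}" using YZ sub_Int by auto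
      then show ?thesis using add[of "Y \<union> Z - S" "Y \<inter> Z"] YZ B by (simp add: Un Int Diff)
    qed
    also have "\<dots> \<le> sup_variation B d S + sup_variation B d T"
      using YZ B sub_Un sub_Int by (intro add_mono sup_variation_upper d) auto
    finally show ?thesis .
  qed
  then show ?thesis
    unfolding sup_variation_def[of B d P] sup_variation_def[of B d Q]
    by (intro cSup_add_cSup_le) auto
qed

lemma sup_variation_mono:
  assumes "algebra J B" "charge B d" "P \<subseteq> S" "S \<in> B"
  shows "sup_variation B d P \<le> sup_variation B d S"
proof -
  interpret algebra J B by fact
  show ?thesis
    using sup_variation_add_le[of J B d S "{}" P "{}"] assms by simp
qed

lemma sup_variation_nonneg:
  assumes "algebra J B" "charge B d" "S \<in> B"
  shows "0 \<le> sup_variation B d S"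
  using sup_variation_mono[OF assms(1,2) _ assms(3), of "{}"] sup_variation_empty[OF assms(1,2)]
  by simp

text \<open>The set \<open>Y\<close> on which \<open>\<beta> - \<alpha>\<close> is evaluated plays
  the part of the complement in the join: by additivity, \<open>\<alpha> X + (\<beta> Y - \<alpha>
  Y) = \<alpha> (X - Y) + \<beta> Y\<close>.\<close>

lemma sup_variation_le_setfun_join:
  assumes "algebra J B" "charge B \<alpha>" "charge B \<beta>" "X \<in> B"
  shows "\<alpha> X + sup_variation B (\<lambda>Y. \<beta> Y - \<alpha> Y) X \<le> setfun_join B \<alpha> \<beta> X"
proof -
  interpret algebra J B by fact
  have "\<beta> Y - \<alpha> Y \<le> setfun_join B \<alpha> \<beta> X - \<alpha> X" if Y: "Y \<in> B" "Y \<subseteq> X" for Y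
  proof -
    have "\<alpha> (X - Y) + \<beta> (X - (X - Y)) \<le> setfun_join B \<alpha> \<beta> X"
      unfolding setfun_join_def
      by (rule cSup_upper[OF _ setfun_join_bdd_above[OF assms]]) (use Y assms(4) in blast)
    moreover have "X - (X - Y) = Y" using Y by auto
    moreover have "\<alpha> X = \<alpha> Y + \<alpha> (X - Y)"
      using additiveD[of B \<alpha> Y "X - Y"] Y assms(2,4) by (simp add: charge_def Un_absorb1 Diff)
    ultimately show ?thesis by simp
  qed
  then have "sup_variation B (\<lambda>Y. \<beta> Y - \<alpha> Y) X \<le> setfun_join B \<alpha> \<beta> X - \<alpha> X"
    unfolding sup_variation_def by (intro cSUP_least) auto
  then show ?thesis by simp
qed

section \<open>Differences with charges, and a charge below two bounds\<close>

lemma charge_diff: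
  assumes "charge B \<alpha>" "charge B \<beta>"
  shows "charge B (\<lambda>X. \<beta> X - \<alpha> X)"
proof -
  have "bounded ((\<lambda>X. \<beta> X - \<alpha> X) ` B)"
    using bounded_minus_comp[of \<beta> B \<alpha>] assms by (simp add: charge_def)
  then show ?thesis
    using assms by (auto simp: charge_def additive_def)
qed

lemma charge_add:
  assumes "charge B \<alpha>" "charge B \<beta>"
  shows "charge B (\<lambda>X. \<alpha> X + \<beta> X)"
proof -
  have "bounded ((\<lambda>X. \<alpha> X + \<beta> X) ` B)"
    using bounded_plus_comp[of \<alpha> B \<beta>] assms by (simp add: charge_def)
  then show ?thesis
    using assms by (auto simp: charge_def additive_def)
qed

text \<open>A charge is modular, so subtracting it changes both sides of the submodular inequality
  equally.\<close>

lemma submodular_on_diff_charge: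
  assumes "algebra J B" "submodular_on B \<phi>" "charge B \<alpha>"
  shows "submodular_on B (\<lambda>X. \<phi> X - \<alpha> X)"
  unfolding submodular_on_def
proof (intro ballI)
  interpret algebra J B by fact
  fix S T assume ST: "S \<in> B" "T \<in> B"
  have add: "\<alpha> (U \<union> V) = \<alpha> U + \<alpha> V" if "U \<inter> V = {}" "U \<in> B" "V \<in> B" for U V
    using assms(3) that additiveD by (auto simp: charge_def)
  have "\<alpha> (S \<union> T) = \<alpha> S + \<alpha> (T - S)"
    using add[of S "T - S"] ST by auto
  moreover have "\<alpha> T = \<alpha> (T - S) + \<alpha> (S \<inter> T)"
  proof -
    have "(T - S) \<inter> (S \<inter> T) = {}" "(T - S) \<union> (S \<inter> T) = T" by auto
    then show ?thesis using add[of "T - S" "S \<inter> T"] ST by auto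
  qed
  ultimately show "\<phi> (S \<union> T) - \<alpha> (S \<union> T) + (\<phi> (S \<inter> T) - \<alpha> (S \<inter> T)) \<le> \<phi> S - \<alpha> S + (\<phi> T - \<alpha> T)"
    using submodular_onD[OF assms(2) ST] by simp
qed

text \<open>Applied with \<open>g = \<phi> - \<alpha>\<close> and
  \<open>d = \<beta> - \<alpha>\<close>. Subtracting \<open>\<alpha>\<close> can destroy
  monotonicity; the infimal convolution of \<open>g\<close> with the upper variation of
  \<open>d\<close> restores it.\<close>

lemma dominated_charge_between:
  assumes "algebra J B" and d: "charge B d" and "submodular_on B g" "g {} = 0"
    and nn: "setfun_le B (\<lambda>_. 0) g" and dg: "setfun_le B d g"
  shows "\<exists>\<delta>. charge B \<delta> \<and> setfun_le B (\<lambda>_. 0) \<delta> \<and> setfun_le B \<delta> g \<and>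
    setfun_le B \<delta> (sup_variation B d) \<and> d J \<le> \<delta> J"
proof -
  interpret algebra J B by fact
  let ?\<nu> = "sup_variation B d"
  \<comment> \<open>Here \<open>Y\<close> ranges over all of \<open>B\<close> and not only over
    subsets of \<open>X\<close>, so \<open>X\<close> enters only through
    \<open>?\<nu> (X - Y)\<close>, which increases with \<open>X\<close>.\<close>
  define \<psi> where "\<psi> X = (INF Y\<in>B. g Y + ?\<nu> (X - Y))" for X
  have nonneg: "0 \<le> g Y + ?\<nu> (X - Y)" if "X \<in> B" "Y \<in> B" for X Y
    using that nn sup_variation_nonneg[OF assms(1) d, of "X - Y"] by (auto simp: setfun_le_def Diff)
  have lower: "\<psi> X \<le> g Y + ?\<nu> (X - Y)" if "X \<in> B" "Y \<in> B" for X Y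
    unfolding \<psi>_def by (rule cINF_lower) (use that nonneg in \<open>auto intro!: bdd_belowI2[of _ 0]\<close>)
  have greatest: "k \<le> \<psi> X" if "\<And>Y. Y \<in> B \<Longrightarrow> k \<le> g Y + ?\<nu> (X - Y)" for k X
    unfolding \<psi>_def by (rule cINF_greatest) (use that in auto)
  have le_g: "\<psi> X \<le> g X" and le_\<nu>: "\<psi> X \<le> ?\<nu> X" if "X \<in> B" for X
    using lower[of X X] lower[of X "{}"] that sup_variation_empty[OF assms(1) d] \<open>g {} = 0\<close> by simp_all
  have "increasing B \<psi>"
  proof (intro increasingI greatest)
    fix S T Y assume *: "S \<subseteq> T" "S \<in> B" "T \<in> B" "Y \<in> B"
    have "?\<nu> (S - Y) \<le> ?\<nu> (T - Y)"
      using * by (intro sup_variation_mono[OF assms(1) d]) auto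
    then show "\<psi> S \<le> g Y + ?\<nu> (T - Y)"
      using lower[of S Y] * by simp
  qed
  moreover have "submodular_on B \<psi>"
    unfolding submodular_on_def
  proof (intro ballI)
    fix S T assume ST: "S \<in> B" "T \<in> B"
    have "\<psi> (S \<union> T) + \<psi> (S \<inter> T) \<le> (g Y + ?\<nu> (S - Y)) + (g Z + ?\<nu> (T - Z))"
      if YZ: "Y \<in> B" "Z \<in> B" for Y Z
    proof -
      \<comment> \<open>For \<open>S \<union> T\<close> and \<open>S \<inter> T\<close> the
        competitors are \<open>Y \<union> Z\<close> and \<open>Y \<inter> Z\<close>. The
        \<open>g\<close> terms are compared by submodularity, the \<open>?\<nu>\<close> terms by the
        indicator inequality of \<open>sup_variation_add_le\<close>.\<close>
      have "?\<nu> (S \<union> T - (Y \<union> Z)) + ?\<nu> (S \<inter> T - (Y \<inter> Z)) \<le> ?\<nu> (S - Y) + ?\<nu> (T - Z)"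
        using ST YZ by (intro sup_variation_add_le[OF assms(1) d]) auto
      then show ?thesis
        using lower[of "S \<union> T" "Y \<union> Z"] lower[of "S \<inter> T" "Y \<inter> Z"] ST YZ
          submodular_onD[OF assms(3) YZ] by (simp add: Un Int)
    qed
    then show "\<psi> (S \<union> T) + \<psi> (S \<inter> T) \<le> \<psi> S + \<psi> T"
      unfolding \<psi>_def[of S] \<psi>_def[of T] by (intro le_cInf_add_cInf) auto
  qed
  moreover have "\<psi> {} = 0"
    using le_g[of "{}"] greatest[of 0 "{}"] nonneg[of "{}"] \<open>g {} = 0\<close> by fastforce
  ultimately obtain \<delta> where \<delta>: "charge B \<delta>" "setfun_le B (\<lambda>_. 0) \<delta>" "setfun_le B \<delta> \<psi>" "\<delta> J = \<psi> J"
    using increasing_submodular_dominates_charge[OF assms(1)] by blast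
  \<comment> \<open>Each competitor \<open>Y\<close> splits \<open>J\<close>: \<open>d\<close> is
    bounded by \<open>g\<close> on \<open>Y\<close> and by \<open>?\<nu>\<close> on
    \<open>J - Y\<close>.\<close>
  have "d J \<le> \<psi> J"
  proof (rule greatest)
    fix Y assume Y: "Y \<in> B"
    then have "Y \<union> (J - Y) = J" using sets_into_space by blast
    then have "d J = d Y + d (J - Y)"
      using additiveD[of B d Y "J - Y"] Y d by (simp add: charge_def Diff)
    moreover have "d Y \<le> g Y" using dg Y by (simp add: setfun_le_def)
    moreover have "d (J - Y) \<le> ?\<nu> (J - Y)" using Y by (intro sup_variation_upper[OF d]) auto
    ultimately show "d J \<le> g Y + ?\<nu> (J - Y)" by simp
  qed
  then show ?thesis
    using \<delta> le_g le_\<nu> unfolding setfun_le_def by (metis order_trans)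
qed

theorem mainTheorem6:
  fixes J :: "'a set" and B :: "'a set set" and \<phi> :: "'a set \<Rightarrow> real"
  assumes "algebra J B"
    and "increasing B \<phi>"
    and "submodular_on B \<phi>"
    and "\<phi> {} = 0"
  shows "\<forall>\<alpha>\<in>mm_plus B \<phi>. \<forall>\<beta>\<in>mm_plus B \<phi>. \<exists>\<gamma>\<in>mm_plus B \<phi>.
    setfun_le B \<alpha> \<gamma> \<and> setfun_le B \<gamma> (setfun_join B \<alpha> \<beta>) \<and> \<beta> J \<le> \<gamma> J"
proof (intro ballI)
  interpret algebra J B by fact
  fix \<alpha> \<beta> assume "\<alpha> \<in> mm_plus B \<phi>" "\<beta> \<in> mm_plus B \<phi>"
  then have \<alpha>: "charge B \<alpha>" "\<And>X. X \<in> B \<Longrightarrow> 0 \<le> \<alpha> X" "\<And>X. X \<in> B \<Longrightarrow> \<alpha> X \<le> \<phi> X"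
    and \<beta>: "charge B \<beta>" "\<And>X. X \<in> B \<Longrightarrow> \<beta> X \<le> \<phi> X"
    by (auto simp: mm_plus_def setfun_le_def)
  let ?d = "\<lambda>X. \<beta> X - \<alpha> X" and ?g = "\<lambda>X. \<phi> X - \<alpha> X"
  have d: "charge B ?d" using charge_diff[OF \<alpha>(1) \<beta>(1)] .
  have "?g {} = 0"
    using \<alpha>(1) additive_empty_real[of B \<alpha>] \<open>\<phi> {} = 0\<close> by (simp add: charge_def)
  \<comment> \<open>The bound \<open>\<alpha> \<le> \<phi>\<close> makes \<open>?g\<close>
    nonnegative on \<open>B\<close>, and \<open>\<beta> \<le> \<phi>\<close> puts \<open>?d\<close>
    below \<open>?g\<close>.\<close>
  then obtain \<delta> where \<delta>: "charge B \<delta>" "setfun_le B (\<lambda>_. 0) \<delta>" "setfun_le B \<delta> ?g"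
      "setfun_le B \<delta> (sup_variation B ?d)" "?d J \<le> \<delta> J"
    using dominated_charge_between[OF assms(1) d submodular_on_diff_charge[OF assms(1,3) \<alpha>(1)]] \<alpha> \<beta>
    by (auto simp: setfun_le_def)
  let ?\<gamma> = "\<lambda>X. \<alpha> X + \<delta> X"
  have "?\<gamma> \<in> mm_plus B \<phi>"
    using charge_add[OF \<alpha>(1) \<delta>(1)] \<alpha> \<delta>(2,3) by (fastforce simp: mm_plus_def setfun_le_def)
  moreover have "setfun_le B \<alpha> ?\<gamma>" "\<beta> J \<le> ?\<gamma> J"
    using \<delta>(2,5) by (auto simp: setfun_le_def)
  moreover have "setfun_le B ?\<gamma> (setfun_join B \<alpha> \<beta>)"
    using \<delta>(4) sup_variation_le_setfun_join[OF assms(1) \<alpha>(1) \<beta>(1)]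
    by (fastforce simp: setfun_le_def)
  ultimately show "\<exists>\<gamma>\<in>mm_plus B \<phi>.
      setfun_le B \<alpha> \<gamma> \<and> setfun_le B \<gamma> (setfun_join B \<alpha> \<beta>) \<and> \<beta> J \<le> \<gamma> J"
    by blast
qed

end
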